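(* Let $G$ be an abelian group with torsion subgroup $H$, and let $R=\bigoplus_{n\in G}R_n$ be a $G$-graded commutative ring. Then every idempotent of $R$ is contained in the subring $\bigoplus_{h\in H}R_h$.
   Context: Rings have an identity. A $G$-graded ring is a ring $R$ with a decomposition $R=\bigoplus_{n\in G}R_n$ of its additive group into subgroups with $R_mR_n\subseteq R_{m+n}$ for all $m,n\in G$. The torsion subgroup of $G$ is the subgroup of elements of finite order. *)

theory Defs
  imports "HOL-Algebra.Algebra"
begin

definition torsion_subgroup :: "('g, 'm) monoid_scheme \<Rightarrow> 'g set" where
  "torsion_subgroup G = {g \<in> carrier G. \<exists>n::nat. n > 0 \<and> g [^]\<^bsub>G\<^esub> n = \<one>\<^bsub>G\<^esub>}"

lemma (in comm_group) subgroup_torsion_subgroup: "subgroup (torsion_subgroup G) G"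
proof
  show "torsion_subgroup G \<subseteq> carrier G"
    by (auto simp: torsion_subgroup_def)
  show "\<one> \<in> torsion_subgroup G"
    by (auto simp: torsion_subgroup_def)
next
  fix x y assume "x \<in> torsion_subgroup G" "y \<in> torsion_subgroup G"
  then obtain m n :: nat where
    x: "x \<in> carrier G" "m > 0" "x [^] m = \<one>" and y: "y \<in> carrier G" "n > 0" "y [^] n = \<one>"
    by (auto simp: torsion_subgroup_def)
  have "x [^] (m * n) = \<one>"
    using x by (simp flip: nat_pow_pow)
  moreover have "y [^] (m * n) = \<one>"
    using y by (simp add: mult.commute[of m] flip: nat_pow_pow)
  ultimately have "(x \<otimes> y) [^] (m * n) = \<one>"
    using x y by (simp add: nat_pow_distrib)
  with x y show "x \<otimes> y \<in> torsion_subgroup G"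
    by (auto simp: torsion_subgroup_def intro!: exI[of _ "m * n"])
next
  fix x assume "x \<in> torsion_subgroup G"
  then show "inv x \<in> torsion_subgroup G"
    by (auto simp: torsion_subgroup_def nat_pow_inv)
qed

text \<open>
  The elements of the external direct sum of the additive groups \<open>A n\<close>, \<open>n \<in> I\<close>.
  Families are extensional, i.e. \<open>undefined\<close> outside \<open>I\<close>, so that equality of
  functions is equality of families.
\<close>

definition finite_families :: "('a, 'r) ring_scheme \<Rightarrow> ('g \<Rightarrow> 'a set) \<Rightarrow> 'g set \<Rightarrow> ('g \<Rightarrow> 'a) set" where
  "finite_families R A I = {f \<in> \<Pi>\<^sub>E n\<in>I. A n. finite {n \<in> I. f n \<noteq> \<zero>\<^bsub>R\<^esub>}}"

text \<open>
  The sum is taken over the support because \<^const>\<open>finsum\<close> over an infinite index set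
  is \<open>\<zero>\<close> by convention.
\<close>

definition family_sum :: "('a, 'r) ring_scheme \<Rightarrow> 'g set \<Rightarrow> ('g \<Rightarrow> 'a) \<Rightarrow> 'a" where
  "family_sum R I f = finsum R f {n \<in> I. f n \<noteq> \<zero>\<^bsub>R\<^esub>}"

definition component_sum :: "('a, 'r) ring_scheme \<Rightarrow> ('g \<Rightarrow> 'a set) \<Rightarrow> 'g set \<Rightarrow> 'a set" where
  "component_sum R A I = family_sum R I ` finite_families R A I"

text \<open>
  The grading group is written multiplicatively, as \<^locale>\<open>comm_group\<close> requires. The
  bijection says that every element of \<open>R\<close> is a sum of homogeneous components, finitely
  many of them nonzero, in exactly one way.
\<close>

locale graded_ring = G?: comm_group G + R?: ring R
  for G :: "('g, 'm) monoid_scheme" and R :: "('a, 'r) ring_scheme" +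
  fixes A :: "'g \<Rightarrow> 'a set"
  assumes component_subgroup: "n \<in> carrier G \<Longrightarrow> additive_subgroup (A n) R"
    and component_mult:
      "\<lbrakk>m \<in> carrier G; n \<in> carrier G; x \<in> A m; y \<in> A n\<rbrakk> \<Longrightarrow> x \<otimes>\<^bsub>R\<^esub> y \<in> A (m \<otimes>\<^bsub>G\<^esub> n)"
    and direct_sum:
      "bij_betw (family_sum R (carrier G)) (finite_families R A (carrier G)) (carrier R)"

end

theory Submission
  imports Defs
begin

text \<open>
  Coarsening the grading along \<open>G \<rightarrow> G/H\<close>, we may assume that the grading group \<open>Q\<close> is torsion-free.
  Let \<open>e = \<Sum> e\<^sub>c\<close> be idempotent and let \<open>T\<close> be the finite set of all \<open>c \<noteq> 0\<close> with \<open>e\<^sub>c\<close> not nilpotent.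
  If \<open>T\<close> is nonempty, some \<open>s \<in> T\<close> is an extreme point of \<open>T \<union> {0}\<close>: \<open>2s = a + b\<close> with
  \<open>a, b \<in> T \<union> {0}\<close> forces \<open>a = b = s\<close>. In particular \<open>2s \<notin> T\<close>, so comparing the components of degree
  \<open>2s\<close> in \<open>e\<^sup>2 = e\<close> modulo nilpotents gives \<open>e\<^sub>s\<^sup>2 = 0\<close>, a contradiction. Hence \<open>e\<close> differs from \<open>e\<^sub>0\<close> by
  a nilpotent element. Newton's iteration started at \<open>e\<^sub>0\<close> then reaches \<open>e\<close> after finitely many steps
  without leaving the component of degree \<open>0\<close>.
\<close>

subsection \<open>Extreme points in torsion-free abelian groups\<close>

lemma (in comm_monoid) finprod_nat_pow:
  assumes "f \<in> A \<rightarrow> carrier G"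
  shows "(\<Otimes>x\<in>A. f x) [^] (n::nat) = (\<Otimes>x\<in>A. f x [^] n)"
  using assms by (induction n) (auto simp: Pi_def simp flip: finprod_multf)

lemma (in group) nat_pow_cancel:
  fixes k l :: nat
  assumes "x \<in> carrier G" "y \<in> carrier G" "l \<le> k" "x [^] k = y \<otimes> x [^] l"
  shows "x [^] (k - l) = y"
proof -
  have "x [^] (k - l) \<otimes> x [^] l = y \<otimes> x [^] l"
    using assms by (simp add: nat_pow_mult)
  then show ?thesis
    using assms by simp
qed

locale torsion_free_comm_group = comm_group +
  assumes torsion_free: "\<lbrakk>x \<in> carrier G; n > (0::nat); x [^] n = \<one>\<rbrakk> \<Longrightarrow> x = \<one>"
begin

lemma nat_pow_inj:
  assumes "x \<in> carrier G" "y \<in> carrier G" "n > (0::nat)" "x [^] n = y [^] n"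
  shows "x = y"
proof -
  have "(x \<otimes> inv y) [^] n = \<one>"
    using assms by (simp add: nat_pow_distrib nat_pow_inv)
  then have "x \<otimes> inv y = \<one>"
    using assms torsion_free[of "x \<otimes> inv y" n] by simp
  then show ?thesis
    using assms inv_equality[of x "inv y"] by simp
qed

text \<open>
  Additively, the hypothesis says that every \<open>s \<in> S\<close> is a nontrivial convex combination of
  \<open>S \<union> {0}\<close>. Eliminating the elements of \<open>S\<close> one at a time preserves it.
\<close>

lemma no_extreme_point_imp_empty:
  assumes "finite S" "S \<subseteq> carrier G - {\<one>}"
    and "\<And>s. s \<in> S \<Longrightarrow> \<exists>(n::nat) m. m s < n \<and> sum m S \<le> n \<and> s [^] n = (\<Otimes>t\<in>S. t [^] (m t))"
  shows "S = {}"
  using assms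
proof (induction S rule: finite_induct)
  case (insert r S)
  have r: "r \<in> carrier G" "r \<noteq> \<one>" and S: "S \<subseteq> carrier G"
    using insert.prems(1) by auto
  have pow [simp]: "(\<lambda>t. t [^] m t) \<in> S \<rightarrow> carrier G" for m :: "_ \<Rightarrow> nat"
    using S by auto
  have fin: "(\<Otimes>t\<in>insert r S. t [^] m t) = r [^] m r \<otimes> (\<Otimes>t\<in>S. t [^] m t)" for m :: "_ \<Rightarrow> nat"
    using insert.hyps r by simp
  obtain k :: nat and l where l: "l r < k" "l r + sum l S \<le> k"
      "r [^] k = r [^] l r \<otimes> (\<Otimes>t\<in>S. t [^] l t)"
    using insert.prems(2)[of r] insert.hyps by (auto simp: fin)
  \<comment> \<open>Cancelling the multiple of \<open>r\<close> leaves, additively,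
    \<open>K r\<close> as a combination of \<open>S\<close> with coefficients \<open>l\<close> and
    total weight at most \<open>K\<close>; positivity of \<open>K\<close> is the nontriviality of
    the relation.\<close>
  define K where "K = k - l r"
  have K: "K > 0" "sum l S \<le> K"
    using l by (auto simp: K_def)
  have rK: "r [^] K = (\<Otimes>t\<in>S. t [^] l t)"
    unfolding K_def using l r by (intro nat_pow_cancel) (auto simp: m_comm)
  have "S = {}"
  proof (rule insert.IH)
    show "S \<subseteq> carrier G - {\<one>}"
      using insert.prems(1) by auto
    fix s assume s: "s \<in> S"
    then have sG: "s \<in> carrier G" "s \<noteq> r"
      using S insert.hyps by auto
    obtain n :: nat and m where m: "m s < n" "m r + sum m S \<le> n"
        "s [^] n = r [^] m r \<otimes> (\<Otimes>t\<in>S. t [^] m t)"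
      using insert.prems(2)[of s] s insert.hyps by (auto simp: fin)
    \<comment> \<open>Multiplying the relation of \<open>s\<close> by \<open>K\<close> and
      substituting for \<open>K r\<close> eliminates \<open>r\<close>; \<open>p\<close> collects the
      new coefficients.\<close>
    define p where "p t = l t * m r + m t * K" for t
    have "s [^] (n * K) = (r [^] m r \<otimes> (\<Otimes>t\<in>S. t [^] m t)) [^] K"
      using sG m(3) by (simp flip: nat_pow_pow)
    also have "\<dots> = r [^] (K * m r) \<otimes> (\<Otimes>t\<in>S. t [^] m t) [^] K"
      using r by (simp add: nat_pow_distrib nat_pow_pow mult.commute)
    also have "r [^] (K * m r) = (\<Otimes>t\<in>S. t [^] l t) [^] m r"
      using r by (simp add: rK flip: nat_pow_pow)
    also have "\<dots> \<otimes> (\<Otimes>t\<in>S. t [^] m t) [^] K = (\<Otimes>t\<in>S. (t [^] l t) [^] m r \<otimes> (t [^] m t) [^] K)"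
      using S by (subst finprod_multf) (auto simp: finprod_nat_pow subset_iff Pi_def)
    also have "\<dots> = (\<Otimes>t\<in>S. t [^] p t)"
      using S by (intro finprod_cong) (auto simp: p_def nat_pow_pow nat_pow_mult subset_iff simp_implies_def)
    finally have eq: "s [^] (n * K) = (\<Otimes>t\<in>S. t [^] p t)" .
    have "sum p S = sum l S * m r + sum m S * K"
      by (simp add: p_def sum.distrib sum_distrib_right)
    also have "\<dots> \<le> (m r + sum m S) * K"
      using K by (simp add: algebra_simps)
    also have "\<dots> \<le> n * K"
      using m by (intro mult_right_mono) auto
    finally have le: "sum p S \<le> n * K" .
    \<comment> \<open>The new relation has to stay nontrivial. Equality would force
      \<open>l s = K\<close>, putting all weight in the relation of \<open>r\<close> on
      \<open>s\<close>; then \<open>K r = K s\<close>, and torsion-freeness gives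
      \<open>r = s\<close>.\<close>
    have "p s \<noteq> n * K"
    proof
      assume ps: "p s = n * K"
      have ls: "sum l S = l s + sum l (S - {s})" and ms: "sum m S = m s + sum m (S - {s})"
        using s insert.hyps by (auto simp: sum.remove)
      have "l s * m r \<le> K * m r"
        using K ls by (intro mult_right_mono) auto
      moreover have "m r * K + m s * K \<le> n * K"
        using m ms by (simp flip: add_mult_distrib)
      moreover have "l s * m r + m s * K = n * K" "K * m r = m r * K"
        using ps by (auto simp: p_def)
      ultimately have *: "l s * m r = K * m r" "m r * K + m s * K = n * K"
        by linarith+
      have "m r \<noteq> 0"
      proof
        assume "m r = 0"
        with * m K show False by simp
      qed
      with * have "l s = K" by simp
      then have "sum l (S - {s}) = 0" using K ls by simp
      then have l0: "\<And>t. t \<in> S - {s} \<Longrightarrow> l t = 0"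
        using insert.hyps by simp
      have "r [^] K = (\<Otimes>t\<in>S. if s = t then t [^] l t else \<one>)"
        unfolding rK using S l0 by (intro finprod_cong) (auto simp: simp_implies_def)
      also have "\<dots> = s [^] K"
        using finprod_singleton[OF s insert.hyps(1) pow[of l]] \<open>l s = K\<close> by simp
      finally show False
        using nat_pow_inj[of r s K] r sG K by auto
    qed
    moreover have "p s \<le> sum p S"
      using s insert.hyps by (intro member_le_sum) auto
    ultimately show "\<exists>(n::nat) m. m s < n \<and> sum m S \<le> n \<and> s [^] n = (\<Otimes>t\<in>S. t [^] (m t))"
      using le eq by (intro exI[of _ "n * K"] exI[of _ p]) auto
  qed
  \<comment> \<open>The empty product leaves \<open>K r = 0\<close>, which torsion-freeness excludes
    for \<open>r \<noteq> 0\<close>.\<close>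
  then have False
    using rK torsion_free[of r K] r K by simp
  then show ?case ..
qed simp

text \<open>If every \<open>s\<close> had a relation \<open>2s = a + b\<close> other than
  \<open>2s = s + s\<close>, these relations would satisfy the hypothesis of
  \<open>no_extreme_point_imp_empty\<close> with \<open>n = 2\<close>, where \<open>m\<close> counts
  the occurrences of \<open>t\<close> among \<open>a\<close> and \<open>b\<close>.\<close>

lemma ex_extreme_point:
  assumes T: "finite T" "T \<subseteq> carrier G - {\<one>}" "T \<noteq> {}"
  shows "\<exists>s\<in>T. \<forall>a\<in>insert \<one> T. \<forall>b\<in>insert \<one> T. s \<otimes> s = a \<otimes> b \<longrightarrow> a = s \<and> b = s"
proof (rule ccontr)
  assume neg: "\<not> ?thesis"
  \<comment> \<open>Indicator exponents. The identity is not in \<open>T\<close>, so it carries no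
    weight; this is why the weights are bounded by \<open>n\<close> rather than required to sum to
    \<open>n\<close>.\<close>
  define \<delta> :: "'a \<Rightarrow> 'a \<Rightarrow> nat" where "\<delta> a t = (if t = a then 1 else 0)" for a t
  have \<delta>: "(\<Otimes>t\<in>T. t [^] \<delta> a t) = a" if "a \<in> insert \<one> T" for a
  proof (cases "a = \<one>")
    case True
    then show ?thesis
      using T by (intro trans[OF finprod_one_eqI]) (auto simp: \<delta>_def)
  next
    case False
    have "(\<lambda>t. t) \<in> T \<rightarrow> carrier G"
      using T by auto
    with False have "(\<Otimes>t\<in>T. if a = t then t else \<one>) = a"
      using that T finprod_singleton[of a T "\<lambda>t. t"] by simp
    moreover have "(\<Otimes>t\<in>T. if a = t then t else \<one>) = (\<Otimes>t\<in>T. t [^] \<delta> a t)"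
      using T by (intro finprod_cong) (auto simp: \<delta>_def simp_implies_def Pi_iff subset_iff)
    ultimately show ?thesis by simp
  qed
  have "T = {}"
  proof (rule no_extreme_point_imp_empty[OF T(1,2)])
    fix s assume s: "s \<in> T"
    then obtain a b where ab: "a \<in> insert \<one> T" "b \<in> insert \<one> T" "s \<otimes> s = a \<otimes> b" "\<not> (a = s \<and> b = s)"
      using neg by blast
    have G: "s \<in> carrier G" "a \<in> carrier G" "b \<in> carrier G"
      using s ab T by auto
    \<comment> \<open>By cancellation \<open>a = s\<close> would give \<open>b = s\<close> and
      conversely, so the exponent of \<open>s\<close> is 0, which is below 2.\<close>
    have "a \<noteq> s" "b \<noteq> s"
      using ab G by auto
    have "(\<Otimes>t\<in>T. t [^] (\<delta> a t + \<delta> b t)) = (\<Otimes>t\<in>T. t [^] \<delta> a t \<otimes> t [^] \<delta> b t)"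
      using T by (intro finprod_cong) (auto simp: nat_pow_mult simp_implies_def)
    also have "\<dots> = a \<otimes> b"
      using T ab by (subst finprod_multf) (auto simp: \<delta>)
    also have "\<dots> = s [^] (2::nat)"
      using ab G by (simp add: numeral_2_eq_2)
    finally have "s [^] (2::nat) = (\<Otimes>t\<in>T. t [^] (\<delta> a t + \<delta> b t))" ..
    moreover have "(\<Sum>t\<in>T. \<delta> a t) \<le> 1" for a
      using T(1) by (simp add: \<delta>_def)
    then have "(\<Sum>t\<in>T. \<delta> a t + \<delta> b t) \<le> 2"
      by (metis add_mono one_add_one sum.distrib)
    moreover have "\<delta> a s + \<delta> b s < 2"
      using \<open>a \<noteq> s\<close> \<open>b \<noteq> s\<close> by (simp add: \<delta>_def)
    ultimately show "\<exists>(n::nat) m. m s < n \<and> sum m T \<le> n \<and> s [^] n = (\<Otimes>t\<in>T. t [^] (m t))"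
      by (intro exI[of _ 2] exI[of _ "\<lambda>t. \<delta> a t + \<delta> b t"]) auto
  qed
  with T show False by simp
qed

end

subsection \<open>Nilpotent elements and lifting of idempotents\<close>

context cring
begin

definition nilradical :: "'a set" where
  "nilradical = {x \<in> carrier R. \<exists>n::nat. x [^] n = \<zero>}"

text \<open>Every monomial in the expansion contains \<open>x^m\<close> or \<open>y^n\<close>. The
  factor \<open>z\<close> allows an induction on \<open>m + n\<close> without binomial coefficients:
  splitting off one factor \<open>x \<oplus> y\<close> absorbs \<open>x\<close> or \<open>y\<close>
  into \<open>z\<close> and lowers \<open>m\<close> or \<open>n\<close>.\<close>

lemma add_pow_eq_zero:
  fixes m n :: nat
  assumes "x \<in> carrier R" "y \<in> carrier R" "z \<in> carrier R"
    and "z \<otimes> x [^] m = \<zero>" "z \<otimes> y [^] n = \<zero>"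
  shows "z \<otimes> (x \<oplus> y) [^] (m + n) = \<zero>"
  using assms(3-)
proof (induction "m + n" arbitrary: m n z)
  case (Suc k)
  show ?case
  proof (cases "m = 0 \<or> n = 0")
    case True
    then have "z = \<zero>"
      using Suc.prems by auto
    then show ?thesis
      using assms by simp
  next
    case False
    then obtain m' n' where mn: "m = Suc m'" "n = Suc n'"
      by (metis not0_implies_Suc)
    have x: "(z \<otimes> x) \<otimes> (x \<oplus> y) [^] (m' + n) = \<zero>"
    proof (rule Suc.hyps)
      show "z \<otimes> x \<otimes> x [^] m' = \<zero>"
        using Suc.prems assms mn by (simp add: m_assoc nat_pow_Suc2[symmetric])
      have "z \<otimes> x \<otimes> y [^] n = x \<otimes> (z \<otimes> y [^] n)"
        using Suc.prems(1) assms by (simp add: m_ac)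
      then show "z \<otimes> x \<otimes> y [^] n = \<zero>"
        using Suc.prems assms by simp
    qed (use Suc mn assms in auto)
    have y: "(z \<otimes> y) \<otimes> (x \<oplus> y) [^] (m + n') = \<zero>"
    proof (rule Suc.hyps)
      show "z \<otimes> y \<otimes> y [^] n' = \<zero>"
        using Suc.prems assms mn by (simp add: m_assoc nat_pow_Suc2[symmetric])
      have "z \<otimes> y \<otimes> x [^] m = y \<otimes> (z \<otimes> x [^] m)"
        using Suc.prems(1) assms by (simp add: m_ac)
      then show "z \<otimes> y \<otimes> x [^] m = \<zero>"
        using Suc.prems assms by simp
    qed (use Suc mn assms in auto)
    have "z \<otimes> (x \<oplus> y) [^] (m + n) = z \<otimes> ((x \<oplus> y) \<otimes> (x \<oplus> y) [^] k)"
      using assms by (simp only: Suc.hyps(2)[symmetric] nat_pow_Suc2 a_closed)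
    also have "\<dots> = (z \<otimes> x) \<otimes> (x \<oplus> y) [^] k \<oplus> (z \<otimes> y) \<otimes> (x \<oplus> y) [^] k"
      using Suc.prems(1) assms by (simp add: l_distr r_distr m_assoc)
    also have "\<dots> = \<zero>"
      using x y mn Suc.hyps(2) by simp
    finally show ?thesis .
  qed
qed (use assms in auto)

lemma ideal_nilradical: "ideal nilradical R"
proof (rule idealI[OF ring_axioms])
  show "subgroup nilradical (add_monoid R)"
  proof (rule add.subgroupI)
    show "nilradical \<noteq> {}"
      by (auto simp: nilradical_def intro!: exI[of _ \<zero>] exI[of _ "1::nat"])
    show "\<ominus> x \<in> nilradical" if x: "x \<in> nilradical" for x
    proof -
      obtain n :: nat where n: "x [^] n = \<zero>" and "x \<in> carrier R"
        using x by (auto simp: nilradical_def)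
      moreover from this have "(\<ominus> \<one> \<otimes> x) [^] n = \<zero>"
        by (subst nat_pow_distrib) auto
      ultimately show ?thesis
        by (auto simp: nilradical_def l_minus)
    qed
    show "x \<oplus> y \<in> nilradical" if xy: "x \<in> nilradical" "y \<in> nilradical" for x y
    proof -
      obtain m n :: nat where "x [^] m = \<zero>" "y [^] n = \<zero>" "x \<in> carrier R" "y \<in> carrier R"
        using xy by (auto simp: nilradical_def)
      then show ?thesis
        using add_pow_eq_zero[of x y \<one> m n] by (auto simp: nilradical_def)
    qed
  qed (auto simp: nilradical_def)
  fix a x assume "a \<in> nilradical" "x \<in> carrier R"
  then obtain n :: nat where "a [^] n = \<zero>" "a \<in> carrier R"
    by (auto simp: nilradical_def)
  then show "x \<otimes> a \<in> nilradical" "a \<otimes> x \<in> nilradical"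
    using \<open>x \<in> carrier R\<close> by (auto simp: nilradical_def nat_pow_distrib intro!: exI[of _ n])
qed

lemma nilradical_square:
  assumes "x \<in> carrier R" "x \<otimes> x \<in> nilradical"
  shows "x \<in> nilradical"
proof -
  obtain n :: nat where "(x \<otimes> x) [^] n = \<zero>"
    using assms by (auto simp: nilradical_def)
  then have "x [^] (n + n) = \<zero>"
    using assms by (simp add: nat_pow_distrib nat_pow_mult)
  then show ?thesis
    using assms by (auto simp: nilradical_def)
qed

text \<open>The polynomial \<open>3y^2 - 2y^3\<close> fixes \<open>e\<close>, and its derivative
  \<open>6y - 6y^2\<close> vanishes at \<open>e\<close>, so its difference from \<open>e\<close> is
  divisible by \<open>(y - e)^2\<close>.\<close>

lemma idempotent_step:
  assumes "e \<in> carrier R" "y \<in> carrier R" "e \<otimes> e = e"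
  defines "y2 \<equiv> y \<otimes> y"
  shows "\<exists>w\<in>carrier R. (y2 \<oplus> y2 \<oplus> y2) \<ominus> (y2 \<otimes> y \<oplus> y2 \<otimes> y) \<ominus> e = (y \<ominus> e) \<otimes> (y \<ominus> e) \<otimes> w"
proof -
  define v where "v = y \<ominus> e"
  \<comment> \<open>With \<open>v = y - e\<close> and \<open>e^2 = e\<close> the cofactor is
    \<open>3 - 6e - 2v\<close>. Its positive part \<open>a\<close> and negative part
    \<open>b\<close> are kept apart so that the expansion can be compared without
    subtraction.\<close>
  define a where "a = \<one> \<oplus> \<one> \<oplus> \<one>"
  define b where "b = e \<oplus> e \<oplus> e \<oplus> e \<oplus> e \<oplus> e \<oplus> v \<oplus> v"
  have v: "v \<in> carrier R" and ab: "a \<in> carrier R" "b \<in> carrier R"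
    using assms by (auto simp: v_def a_def b_def)
  have y: "y = e \<oplus> v"
    unfolding v_def using assms(1,2) by algebra
  have ee: "e \<otimes> (e \<otimes> x) = e \<otimes> x" if "x \<in> carrier R" for x
    using assms that by (simp flip: m_assoc)
  have "(y2 \<oplus> y2 \<oplus> y2) \<oplus> v \<otimes> v \<otimes> b = (y2 \<otimes> y \<oplus> y2 \<otimes> y) \<oplus> e \<oplus> v \<otimes> v \<otimes> a"
    unfolding y2_def y a_def b_def using assms(1,3) v
    by (simp add: l_distr r_distr a_ac m_ac ee)
  moreover have "p \<ominus> q \<ominus> e = v \<otimes> v \<otimes> (a \<ominus> b)"
    if "p \<oplus> v \<otimes> v \<otimes> b = q \<oplus> e \<oplus> v \<otimes> v \<otimes> a" "p \<in> carrier R" "q \<in> carrier R" for p q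
  proof -
    have "p = q \<oplus> e \<oplus> v \<otimes> v \<otimes> a \<ominus> v \<otimes> v \<otimes> b"
      using that v ab assms(1) by (metis a_closed add.inv_solve_right m_closed minus_eq)
    then show ?thesis
      using that(3) v ab assms(1) by (simp, algebra)
  qed
  ultimately show ?thesis
    using assms ab unfolding v_def[symmetric] by (intro bexI[of _ "a \<ominus> b"]) (auto simp: y2_def)
qed

text \<open>
  Newton's iteration \<open>y \<mapsto> 3y\<^sup>2 - 2y\<^sup>3\<close> for lifting idempotents stays in \<open>C\<close> and squares the
  distance to \<open>e\<close>.
\<close>

lemma idempotent_mem_if_nilpotent_diff:
  fixes n :: nat
  assumes e: "e \<in> carrier R" "e \<otimes> e = e"
    and C: "C \<subseteq> carrier R" "\<And>x y. \<lbrakk>x \<in> C; y \<in> C\<rbrakk> \<Longrightarrow> x \<oplus> y \<in> C"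
      "\<And>x y. \<lbrakk>x \<in> C; y \<in> C\<rbrakk> \<Longrightarrow> x \<ominus> y \<in> C" "\<And>x y. \<lbrakk>x \<in> C; y \<in> C\<rbrakk> \<Longrightarrow> x \<otimes> y \<in> C"
    and y: "y \<in> C" "(y \<ominus> e) [^] n = \<zero>"
  shows "e \<in> C"
  using y
proof (induction n arbitrary: y rule: less_induct)
  case (less n)
  have yR: "y \<in> carrier R"
    using less.prems C by auto
  show ?case
  proof (cases "n \<le> 1")
    case True
    have "y \<ominus> e = \<zero>"
    proof (cases "n = 0")
      case True
      \<comment> \<open>The power with exponent 0 is \<open>\<one>\<close>, so here the ring is
        trivial.\<close>
      then have "\<one> = \<zero>"
        using less.prems by simp
      then have "carrier R = {\<zero>}"
        by (rule one_zeroD)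
      moreover have "y \<ominus> e \<in> carrier R"
        using e yR by simp
      ultimately show ?thesis
        by blast
    next
      case False
      with True have "n = 1" by simp
      then show ?thesis
        using less.prems e yR by simp
    qed
    then have "y = e"
      using e yR by simp
    then show ?thesis
      using less.prems by simp
  next
    case False
    \<comment> \<open>Half of \<open>n\<close>, rounded up: \<open>n \<ge> 2\<close> gives
      \<open>m < n\<close>, while \<open>2m \<ge> n\<close> makes \<open>d^(2m)\<close> vanish. As
      \<open>y' - e\<close> is a multiple of \<open>d^2\<close>, its \<open>m\<close>-th power is
      zero.\<close>
    define m where "m = (n + 1) div 2"
    have m: "m < n" "n \<le> m + m"
      using False by (auto simp: m_def)
    define y2 where "y2 = y \<otimes> y"
    define y' where "y' = y2 \<oplus> y2 \<oplus> y2 \<ominus> (y2 \<otimes> y \<oplus> y2 \<otimes> y)"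
    define d where "d = y \<ominus> e"
    have d: "d \<in> carrier R"
      using e yR by (simp add: d_def)
    have "d [^] (m + m) = d [^] n \<otimes> d [^] (m + m - n)"
      using m d by (simp add: nat_pow_mult)
    then have d0: "d [^] (m + m) = \<zero>"
      using less.prems d by (simp add: d_def)
    obtain w where w: "w \<in> carrier R" "y' \<ominus> e = d \<otimes> d \<otimes> w"
      using idempotent_step[OF e(1) yR e(2)] by (auto simp: y'_def y2_def d_def)
    then have "(y' \<ominus> e) [^] m = d [^] (m + m) \<otimes> w [^] m"
      using d by (simp add: nat_pow_distrib nat_pow_mult)
    also have "\<dots> = \<zero>"
      using d0 w by simp
    finally have "(y' \<ominus> e) [^] m = \<zero>" .
    moreover have "y' \<in> C"
      using less.prems C by (simp add: y'_def y2_def)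
    ultimately show ?thesis
      using less.IH m by blast
  qed
qed

end

subsection \<open>Idempotents in rings graded by torsion-free groups\<close>

text \<open>
  Gradings are encoded by the projections onto the components: these are easily summed over
  cosets, so that passing to a quotient of the grading group needs no new direct sum bijection.
\<close>

locale graded_projections = Q?: comm_group Q + R?: cring R
  for Q :: "('q, 'm) monoid_scheme" and R :: "('a, 'r) ring_scheme" +
  fixes \<pi> :: "'q \<Rightarrow> 'a \<Rightarrow> 'a"
  assumes proj_closed: "\<lbrakk>c \<in> carrier Q; x \<in> carrier R\<rbrakk> \<Longrightarrow> \<pi> c x \<in> carrier R"
    and proj_add: "\<lbrakk>c \<in> carrier Q; x \<in> carrier R; y \<in> carrier R\<rbrakk> \<Longrightarrow> \<pi> c (x \<oplus>\<^bsub>R\<^esub> y) = \<pi> c x \<oplus>\<^bsub>R\<^esub> \<pi> c y"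
    and proj_proj: "\<lbrakk>c \<in> carrier Q; x \<in> carrier R\<rbrakk> \<Longrightarrow> \<pi> c (\<pi> c x) = \<pi> c x"
    and proj_mult: "\<lbrakk>a \<in> carrier Q; b \<in> carrier Q; c \<in> carrier Q; x \<in> carrier R; y \<in> carrier R\<rbrakk> \<Longrightarrow>
      \<pi> c (\<pi> a x \<otimes>\<^bsub>R\<^esub> \<pi> b y) = (if c = a \<otimes>\<^bsub>Q\<^esub> b then \<pi> a x \<otimes>\<^bsub>R\<^esub> \<pi> b y else \<zero>\<^bsub>R\<^esub>)"
    and ex_decomposition: "x \<in> carrier R \<Longrightarrow>
      \<exists>F. finite F \<and> F \<subseteq> carrier Q \<and> (\<forall>c\<in>carrier Q - F. \<pi> c x = \<zero>\<^bsub>R\<^esub>) \<and> (\<Oplus>\<^bsub>R\<^esub>c\<in>F. \<pi> c x) = x"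
begin

lemma proj_zero: "c \<in> carrier Q \<Longrightarrow> \<pi> c \<zero>\<^bsub>R\<^esub> = \<zero>\<^bsub>R\<^esub>"
  using proj_add[of c "\<zero>\<^bsub>R\<^esub>" "\<zero>\<^bsub>R\<^esub>"] proj_closed[of c "\<zero>\<^bsub>R\<^esub>"] R.add.r_cancel_one' by auto

lemma proj_finsum:
  assumes "c \<in> carrier Q" "f \<in> F \<rightarrow> carrier R"
  shows "\<pi> c (\<Oplus>\<^bsub>R\<^esub>i\<in>F. f i) = (\<Oplus>\<^bsub>R\<^esub>i\<in>F. \<pi> c (f i))"
  using assms(2)
proof (induction F rule: infinite_finite_induct)
  case (insert i F)
  then show ?case
    using assms(1) by (simp add: proj_add proj_closed Pi_def)
qed (use assms(1) in \<open>auto simp: proj_zero\<close>)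

end

section \<open>Isolating one term of a finite sum modulo an ideal\<close>

lemma (in abelian_group) finsum_remove:
  assumes "finite F" "s \<in> F" "f \<in> F \<rightarrow> carrier G"
  shows "(\<Oplus>i\<in>F. f i) = f s \<oplus> (\<Oplus>i\<in>F - {s}. f i)"
proof -
  have "F = insert s (F - {s})"
    using assms by auto
  then have "(\<Oplus>i\<in>F. f i) = (\<Oplus>i\<in>insert s (F - {s}). f i)"
    by simp
  also have "\<dots> = f s \<oplus> (\<Oplus>i\<in>F - {s}. f i)"
    using assms by (intro finsum_insert) auto
  finally show ?thesis .
qed

lemma (in ideal) finsum_closed:
  assumes "\<And>i. i \<in> F \<Longrightarrow> f i \<in> I"
  shows "(\<Oplus>i\<in>F. f i) \<in> I"
  using assms
proof (induction F rule: infinite_finite_induct)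
  case (insert i F)
  then show ?case
    by (subst finsum_insert) (auto intro: a_Hcarr additive_subgroup.a_closed[OF is_additive_subgroup])
qed auto

lemma (in ideal) mem_if_add_mem:
  assumes "x \<in> carrier R" "y \<in> I" "x \<oplus> y \<in> I"
  shows "x \<in> I"
proof -
  have "x = (x \<oplus> y) \<oplus> \<ominus> y"
    using assms(1) a_Hcarr[OF assms(2)] by algebra
  then show ?thesis
    using assms additive_subgroup.a_closed[OF is_additive_subgroup]
      additive_subgroup.a_inv_closed[OF is_additive_subgroup] by metis
qed

text \<open>Modulo \<open>I\<close> the sum reduces to the single term \<open>f s\<close>.\<close>

lemma (in ideal) mem_if_finsum_mem:
  assumes "finite F" "s \<in> F" "f \<in> F \<rightarrow> carrier R"
    and "(\<Oplus>i\<in>F. f i) \<in> I" "\<And>i. i \<in> F - {s} \<Longrightarrow> f i \<in> I"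
  shows "f s \<in> I"
  using assms finsum_remove[of F s f] finsum_closed[of "F - {s}" f]
  by (intro mem_if_add_mem[of "f s" "\<Oplus>i\<in>F - {s}. f i"]) auto

section \<open>The extreme degree argument and the passage to degree zero\<close>

locale torsion_free_graded_projections = graded_projections Q R \<pi> + torsion_free_comm_group Q
  for Q :: "('q, 'm) monoid_scheme" and R :: "('a, 'r) ring_scheme" and \<pi>
begin

lemma idempotent_proj_nilpotent:
  assumes e: "e \<in> carrier R" "e \<otimes>\<^bsub>R\<^esub> e = e" and c: "c \<in> carrier Q" "c \<noteq> \<one>\<^bsub>Q\<^esub>"
  shows "\<pi> c e \<in> nilradical"
proof (rule ccontr)
  assume c_notin: "\<pi> c e \<notin> nilradical"
  interpret N: ideal nilradical R
    by (rule ideal_nilradical)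
  obtain F where F: "finite F" "F \<subseteq> carrier Q" "\<And>c. c \<in> carrier Q - F \<Longrightarrow> \<pi> c e = \<zero>\<^bsub>R\<^esub>"
    and sum: "(\<Oplus>\<^bsub>R\<^esub>c\<in>F. \<pi> c e) = e"
    using ex_decomposition[OF e(1)] by blast
  define T where "T = {c \<in> carrier Q - {\<one>\<^bsub>Q\<^esub>}. \<pi> c e \<notin> nilradical}"
  have "T \<subseteq> F"
    using F N.zero_closed by (force simp: T_def)
  have T: "finite T" "T \<subseteq> carrier Q - {\<one>\<^bsub>Q\<^esub>}" "T \<noteq> {}"
    using c c_notin finite_subset[OF \<open>T \<subseteq> F\<close> F(1)] by (auto simp: T_def)
  obtain s where s: "s \<in> T"
    and extreme: "\<And>a b. \<lbrakk>a \<in> insert \<one>\<^bsub>Q\<^esub> T; b \<in> insert \<one>\<^bsub>Q\<^esub> T; s \<otimes>\<^bsub>Q\<^esub> s = a \<otimes>\<^bsub>Q\<^esub> b\<rbrakk> \<Longrightarrow> a = s \<and> b = s"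
    using ex_extreme_point[OF T] by blast
  have sQ: "s \<in> carrier Q" "s \<noteq> \<one>\<^bsub>Q\<^esub>" "s \<in> F"
    using s \<open>T \<subseteq> F\<close> by (auto simp: T_def)
  have pe [simp]: "\<pi> a e \<in> carrier R" if "a \<in> carrier Q" for a
    using that e by (simp add: proj_closed)
  \<comment> \<open>The part of degree \<open>2s\<close> of a product of two components; it is zero
    unless \<open>a\<close> and \<open>b\<close> add up to \<open>2s\<close>.\<close>
  define t where "t a b = \<pi> (s \<otimes>\<^bsub>Q\<^esub> s) (\<pi> a e \<otimes>\<^bsub>R\<^esub> \<pi> b e)" for a b
  have t [simp]: "t a b \<in> carrier R" if "a \<in> F" "b \<in> F" for a b
    using that F sQ by (simp add: t_def proj_closed subset_iff)
  \<comment> \<open>Summed over all pairs, this is the component of degree \<open>2s\<close> of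
    \<open>e^2 = e\<close>.\<close>
  have "(\<Oplus>\<^bsub>R\<^esub>a\<in>F. \<Oplus>\<^bsub>R\<^esub>b\<in>F. t a b) = (\<Oplus>\<^bsub>R\<^esub>a\<in>F. \<pi> (s \<otimes>\<^bsub>Q\<^esub> s) (\<pi> a e \<otimes>\<^bsub>R\<^esub> e))"
  proof (intro R.finsum_cong' refl)
    fix a assume a: "a \<in> F"
    then have "(\<Oplus>\<^bsub>R\<^esub>b\<in>F. t a b) = \<pi> (s \<otimes>\<^bsub>Q\<^esub> s) (\<Oplus>\<^bsub>R\<^esub>b\<in>F. \<pi> a e \<otimes>\<^bsub>R\<^esub> \<pi> b e)"
      unfolding t_def using F sQ by (subst proj_finsum) (auto simp: subset_iff)
    also have "\<dots> = \<pi> (s \<otimes>\<^bsub>Q\<^esub> s) (\<pi> a e \<otimes>\<^bsub>R\<^esub> (\<Oplus>\<^bsub>R\<^esub>b\<in>F. \<pi> b e))"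
      using a F by (subst finsum_rdistr) (auto simp: subset_iff)
    finally show "(\<Oplus>\<^bsub>R\<^esub>b\<in>F. t a b) = \<pi> (s \<otimes>\<^bsub>Q\<^esub> s) (\<pi> a e \<otimes>\<^bsub>R\<^esub> e)"
      by (simp add: sum)
  qed (use e F sQ in \<open>simp add: subset_iff proj_closed\<close>)
  also have "\<dots> = \<pi> (s \<otimes>\<^bsub>Q\<^esub> s) (\<Oplus>\<^bsub>R\<^esub>a\<in>F. \<pi> a e \<otimes>\<^bsub>R\<^esub> e)"
    using e F sQ by (subst proj_finsum) (auto simp: subset_iff)
  also have "\<dots> = \<pi> (s \<otimes>\<^bsub>Q\<^esub> s) ((\<Oplus>\<^bsub>R\<^esub>a\<in>F. \<pi> a e) \<otimes>\<^bsub>R\<^esub> e)"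
    using e F by (subst finsum_ldistr) (auto simp: subset_iff)
  finally have tsum: "(\<Oplus>\<^bsub>R\<^esub>a\<in>F. \<Oplus>\<^bsub>R\<^esub>b\<in>F. t a b) = \<pi> (s \<otimes>\<^bsub>Q\<^esub> s) e"
    using e by (simp add: sum)
  have "s \<otimes>\<^bsub>Q\<^esub> s \<noteq> \<one>\<^bsub>Q\<^esub>"
    using torsion_free[of s 2] sQ by (auto simp: numeral_2_eq_2)
  \<comment> \<open>Otherwise \<open>2s = 2s + 0\<close> would be a decomposition inside
    \<open>T \<union> {0}\<close>, and extremality would give \<open>s = 0\<close>.\<close>
  moreover have "s \<otimes>\<^bsub>Q\<^esub> s \<notin> T"
    using extreme[of "s \<otimes>\<^bsub>Q\<^esub> s" "\<one>\<^bsub>Q\<^esub>"] sQ by auto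
  ultimately have ss: "\<pi> (s \<otimes>\<^bsub>Q\<^esub> s) e \<in> nilradical"
    using sQ by (auto simp: T_def)
  have tN: "t a b \<in> nilradical" if "a \<in> F" "b \<in> F" "\<not> (a = s \<and> b = s)" for a b
  proof (cases "s \<otimes>\<^bsub>Q\<^esub> s = a \<otimes>\<^bsub>Q\<^esub> b")
    case True
    have ab: "a \<in> carrier Q" "b \<in> carrier Q"
      using that F by auto
    \<comment> \<open>By extremality one of the two degrees lies outside
      \<open>T \<union> {0}\<close>, so its component is nilpotent and hence the product is
      too.\<close>
    have "a \<notin> insert \<one>\<^bsub>Q\<^esub> T \<or> b \<notin> insert \<one>\<^bsub>Q\<^esub> T"
      using extreme that(3) True by blast
    then have "\<pi> a e \<in> nilradical \<or> \<pi> b e \<in> nilradical"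
      using ab by (auto simp: T_def)
    then have "\<pi> a e \<otimes>\<^bsub>R\<^esub> \<pi> b e \<in> nilradical"
      using ab N.I_l_closed N.I_r_closed pe by blast
    then show ?thesis
      using True ab e sQ by (simp add: t_def proj_mult)
  next
    case False
    then show ?thesis
      using that F sQ e N.zero_closed by (simp add: t_def proj_mult subset_iff)
  qed
  \<comment> \<open>The term \<open>t s s\<close> is isolated in two rounds: first the row
    \<open>a = s\<close> among all rows, then its entry \<open>b = s\<close>.\<close>
  have "(\<Oplus>\<^bsub>R\<^esub>b\<in>F. t s b) \<in> nilradical"
  proof (rule N.mem_if_finsum_mem[of F s "\<lambda>a. \<Oplus>\<^bsub>R\<^esub>b\<in>F. t a b"])
    show "(\<Oplus>\<^bsub>R\<^esub>b\<in>F. t i b) \<in> nilradical" if "i \<in> F - {s}" for i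
      using that tN by (intro N.finsum_closed) auto
  qed (use F sQ ss tsum in auto)
  then have "t s s \<in> nilradical"
    using F sQ tN by (intro N.mem_if_finsum_mem[of F s "t s"]) auto
  then have "\<pi> s e \<otimes>\<^bsub>R\<^esub> \<pi> s e \<in> nilradical"
    using sQ e by (simp add: t_def proj_mult)
  then have "\<pi> s e \<in> nilradical"
    by (rule nilradical_square[OF pe[OF sQ(1)]])
  with s show False
    by (simp add: T_def)
qed

lemma idempotent_homogeneous:
  assumes e: "e \<in> carrier R" "e \<otimes>\<^bsub>R\<^esub> e = e"
  shows "\<pi> \<one>\<^bsub>Q\<^esub> e = e"
proof -
  interpret N: ideal nilradical R
    by (rule ideal_nilradical)
  \<comment> \<open>The fixed points of the projection form the component of degree zero, in which
    the Newton iteration takes place.\<close>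
  define C where "C = {x \<in> carrier R. \<pi> \<one>\<^bsub>Q\<^esub> x = x}"
  define y where "y = \<pi> \<one>\<^bsub>Q\<^esub> e"
  have y: "y \<in> carrier R" "y \<in> C"
    using e by (auto simp: y_def C_def proj_closed proj_proj)
  obtain F where F: "finite F" "F \<subseteq> carrier Q" "\<And>c. c \<in> carrier Q - F \<Longrightarrow> \<pi> c e = \<zero>\<^bsub>R\<^esub>"
    and sum: "(\<Oplus>\<^bsub>R\<^esub>c\<in>F. \<pi> c e) = e"
    using ex_decomposition[OF e(1)] by blast
  define r where "r = (\<Oplus>\<^bsub>R\<^esub>c\<in>F - {\<one>\<^bsub>Q\<^esub>}. \<pi> c e)"
  have r: "r \<in> nilradical"
    unfolding r_def using F e by (intro N.finsum_closed idempotent_proj_nilpotent) auto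
  have e_eq: "e = y \<oplus>\<^bsub>R\<^esub> r"
  proof (cases "\<one>\<^bsub>Q\<^esub> \<in> F")
    case True
    then show ?thesis
      using finsum_remove[of F "\<one>\<^bsub>Q\<^esub>" "\<lambda>c. \<pi> c e"] F e sum
      by (auto simp: y_def r_def proj_closed subset_iff)
  next
    case False
    then show ?thesis
      using F sum N.a_Hcarr[OF r] by (simp add: y_def r_def)
  qed
  have "y \<ominus>\<^bsub>R\<^esub> (y \<oplus>\<^bsub>R\<^esub> r) = \<ominus>\<^bsub>R\<^esub> r"
    using y(1) N.a_Hcarr[OF r] by algebra
  then have "y \<ominus>\<^bsub>R\<^esub> e = \<ominus>\<^bsub>R\<^esub> r"
    by (simp only: e_eq[symmetric])
  then have "y \<ominus>\<^bsub>R\<^esub> e \<in> nilradical"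
    using r by simp
  then obtain n :: nat where n: "(y \<ominus>\<^bsub>R\<^esub> e) [^]\<^bsub>R\<^esub> n = \<zero>\<^bsub>R\<^esub>"
    unfolding nilradical_def by blast
  have "e \<in> C"
  proof (rule idempotent_mem_if_nilpotent_diff[OF e _ _ _ _ y(2) n])
    show "C \<subseteq> carrier R"
      by (auto simp: C_def)
    fix u v assume "u \<in> C" "v \<in> C"
    then have uv: "u \<in> carrier R" "v \<in> carrier R" "\<pi> \<one>\<^bsub>Q\<^esub> u = u" "\<pi> \<one>\<^bsub>Q\<^esub> v = v"
      by (auto simp: C_def)
    show "u \<oplus>\<^bsub>R\<^esub> v \<in> C"
      using uv by (simp add: C_def proj_add)
    \<comment> \<open>Compatibility with differences follows from additivity, applied to
      \<open>(u - v) + v\<close>.\<close>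
    have "\<pi> \<one>\<^bsub>Q\<^esub> (u \<ominus>\<^bsub>R\<^esub> v) \<oplus>\<^bsub>R\<^esub> v = \<pi> \<one>\<^bsub>Q\<^esub> ((u \<ominus>\<^bsub>R\<^esub> v) \<oplus>\<^bsub>R\<^esub> v)"
      using uv by (simp add: proj_add)
    also have "(u \<ominus>\<^bsub>R\<^esub> v) \<oplus>\<^bsub>R\<^esub> v = u"
      using uv(1,2) by algebra
    finally have "\<pi> \<one>\<^bsub>Q\<^esub> (u \<ominus>\<^bsub>R\<^esub> v) = u \<ominus>\<^bsub>R\<^esub> v"
      using uv proj_closed[of "\<one>\<^bsub>Q\<^esub>" "u \<ominus>\<^bsub>R\<^esub> v"] R.add.inv_solve_right[of "\<pi> \<one>\<^bsub>Q\<^esub> (u \<ominus>\<^bsub>R\<^esub> v)" u v]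
      by (simp add: R.minus_eq)
    then show "u \<ominus>\<^bsub>R\<^esub> v \<in> C"
      using uv by (simp add: C_def)
    show "u \<otimes>\<^bsub>R\<^esub> v \<in> C"
      using uv proj_mult[of "\<one>\<^bsub>Q\<^esub>" "\<one>\<^bsub>Q\<^esub>" "\<one>\<^bsub>Q\<^esub>" u v] by (simp add: C_def)
  qed
  then show ?thesis
    by (simp add: C_def)
qed

end

subsection \<open>Coarsening a grading\<close>

text \<open>Extra indices contribute zero, so several families can be summed over one common finite
  set instead of over their different supports.\<close>

lemma (in abelian_monoid) family_sum_eq_finsum:
  assumes "finite S" "S \<subseteq> I" "f \<in> I \<rightarrow> carrier G" "\<And>i. i \<in> I - S \<Longrightarrow> f i = \<zero>"
  shows "family_sum G I f = (\<Oplus>i\<in>S. f i)"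
  unfolding family_sum_def using assms by (intro add.finprod_mono_neutral_cong_left) auto

section \<open>Homogeneous components and their sums over sets of degrees\<close>

context graded_ring
begin

definition homog :: "'a \<Rightarrow> 'g \<Rightarrow> 'a" where
  "homog = inv_into (finite_families R A (carrier G)) (family_sum R (carrier G))"

text \<open>Here \<open>U\<close> is a set of degrees, so that a coset of a subgroup can serve as a
  single degree of the coarser grading.\<close>

definition projection :: "'g set \<Rightarrow> 'a \<Rightarrow> 'a" where
  "projection U x = family_sum R U (homog x)"

lemma homog_family:
  assumes "x \<in> carrier R"
  shows "homog x \<in> finite_families R A (carrier G)" "family_sum R (carrier G) (homog x) = x"
  using assms bij_betw_imp_surj_on[OF direct_sum]
  by (simp_all add: homog_def inv_into_into f_inv_into_f)

lemma homog_family_sum: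
  assumes "f \<in> finite_families R A (carrier G)"
  shows "homog (family_sum R (carrier G) f) = f"
  using assms direct_sum by (simp add: homog_def bij_betw_def)

lemma component_subset: "g \<in> carrier G \<Longrightarrow> A g \<subseteq> carrier R"
  by (rule additive_subgroup.a_subset[OF component_subgroup])

lemma homog_mem: "\<lbrakk>x \<in> carrier R; g \<in> carrier G\<rbrakk> \<Longrightarrow> homog x g \<in> A g"
  using homog_family(1)[of x] by (auto simp: finite_families_def)

lemma homog_closed [simp]: "\<lbrakk>x \<in> carrier R; g \<in> carrier G\<rbrakk> \<Longrightarrow> homog x g \<in> carrier R"
  using homog_mem component_subset by blast

definition support :: "'a \<Rightarrow> 'g set" where
  "support x = {g \<in> carrier G. homog x g \<noteq> \<zero>\<^bsub>R\<^esub>}"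

lemma finite_support: "x \<in> carrier R \<Longrightarrow> finite (support x)"
  using homog_family(1)[of x] by (auto simp: finite_families_def support_def)

lemma support_subset: "support x \<subseteq> carrier G"
  by (auto simp: support_def)

lemma projection_eq_finsum:
  assumes "x \<in> carrier R" "U \<subseteq> carrier G" "finite S" "support x \<subseteq> S"
  shows "projection U x = (\<Oplus>\<^bsub>R\<^esub>g\<in>U \<inter> S. homog x g)"
  unfolding projection_def using assms
  by (intro R.family_sum_eq_finsum) (auto simp: support_def subset_iff)

lemma projection_closed: "\<lbrakk>x \<in> carrier R; U \<subseteq> carrier G\<rbrakk> \<Longrightarrow> projection U x \<in> carrier R"
  by (subst projection_eq_finsum[OF _ _ finite_support]) (auto intro!: R.finsum_closed)

text \<open>The pointwise sum of the two families is an admissible family with sum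
  \<open>x + y\<close>, so uniqueness of the decomposition identifies it.\<close>

lemma homog_add:
  assumes "x \<in> carrier R" "y \<in> carrier R" "g \<in> carrier G"
  shows "homog (x \<oplus>\<^bsub>R\<^esub> y) g = homog x g \<oplus>\<^bsub>R\<^esub> homog y g"
proof -
  \<comment> \<open>Uniqueness compares functions, so \<open>f\<close> has to be
    \<open>undefined\<close> outside \<open>carrier G\<close>.\<close>
  define f where "f = (\<lambda>h\<in>carrier G. homog x h \<oplus>\<^bsub>R\<^esub> homog y h)"
  define S where "S = support x \<union> support y"
  have S: "finite S" "S \<subseteq> carrier G" "support x \<subseteq> S" "support y \<subseteq> S"
    using assms support_subset by (auto simp: S_def finite_support)
  have f0: "f h = \<zero>\<^bsub>R\<^esub>" if "h \<in> carrier G - S" for h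
    using that by (auto simp: f_def S_def support_def)
  have "{h \<in> carrier G. f h \<noteq> \<zero>\<^bsub>R\<^esub>} \<subseteq> S"
    using f0 by auto
  then have "finite {h \<in> carrier G. f h \<noteq> \<zero>\<^bsub>R\<^esub>}"
    using S(1) by (rule finite_subset)
  moreover have "f \<in> (\<Pi>\<^sub>E h\<in>carrier G. A h)"
    using assms homog_mem additive_subgroup.a_closed[OF component_subgroup] by (auto simp: f_def)
  ultimately have f: "f \<in> finite_families R A (carrier G)"
    by (simp add: finite_families_def)
  have "family_sum R (carrier G) f = (\<Oplus>\<^bsub>R\<^esub>h\<in>S. f h)"
    using S f0 assms by (intro R.family_sum_eq_finsum) (auto simp: f_def)
  also have "\<dots> = (\<Oplus>\<^bsub>R\<^esub>h\<in>S. homog x h \<oplus>\<^bsub>R\<^esub> homog y h)"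
    using S assms by (intro R.finsum_cong') (auto simp: f_def)
  also have "\<dots> = (\<Oplus>\<^bsub>R\<^esub>h\<in>S. homog x h) \<oplus>\<^bsub>R\<^esub> (\<Oplus>\<^bsub>R\<^esub>h\<in>S. homog y h)"
    using S assms by (intro R.finsum_addf) auto
  also have "(\<Oplus>\<^bsub>R\<^esub>h\<in>S. homog x h) = family_sum R (carrier G) (homog x)"
    using S assms by (intro R.family_sum_eq_finsum[symmetric]) (auto simp: support_def)
  also have "(\<Oplus>\<^bsub>R\<^esub>h\<in>S. homog y h) = family_sum R (carrier G) (homog y)"
    using S assms by (intro R.family_sum_eq_finsum[symmetric]) (auto simp: support_def)
  finally have "family_sum R (carrier G) f = x \<oplus>\<^bsub>R\<^esub> y"
    using assms by (simp add: homog_family)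
  then have "homog (x \<oplus>\<^bsub>R\<^esub> y) = f"
    using homog_family_sum[OF f] by simp
  then show ?thesis
    using assms by (simp add: f_def)
qed

lemma support_add:
  assumes "x \<in> carrier R" "y \<in> carrier R"
  shows "support (x \<oplus>\<^bsub>R\<^esub> y) \<subseteq> support x \<union> support y"
  using assms by (auto simp: support_def homog_add)

lemma projection_add:
  assumes "x \<in> carrier R" "y \<in> carrier R" "U \<subseteq> carrier G"
  shows "projection U (x \<oplus>\<^bsub>R\<^esub> y) = projection U x \<oplus>\<^bsub>R\<^esub> projection U y"
proof -
  define S where "S = support x \<union> support y"
  have S: "finite S" "support x \<subseteq> S" "support y \<subseteq> S" "support (x \<oplus>\<^bsub>R\<^esub> y) \<subseteq> S"
    using assms support_add by (auto simp: S_def finite_support)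
  have "projection U (x \<oplus>\<^bsub>R\<^esub> y) = (\<Oplus>\<^bsub>R\<^esub>g\<in>U \<inter> S. homog (x \<oplus>\<^bsub>R\<^esub> y) g)"
    using assms S by (intro projection_eq_finsum) auto
  also have "\<dots> = (\<Oplus>\<^bsub>R\<^esub>g\<in>U \<inter> S. homog x g \<oplus>\<^bsub>R\<^esub> homog y g)"
    using assms by (intro R.finsum_cong') (auto simp: homog_add subset_iff)
  also have "\<dots> = (\<Oplus>\<^bsub>R\<^esub>g\<in>U \<inter> S. homog x g) \<oplus>\<^bsub>R\<^esub> (\<Oplus>\<^bsub>R\<^esub>g\<in>U \<inter> S. homog y g)"
    using assms by (intro R.finsum_addf) (auto simp: subset_iff)
  also have "\<dots> = projection U x \<oplus>\<^bsub>R\<^esub> projection U y"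
    using assms S by (simp add: projection_eq_finsum)
  finally show ?thesis .
qed

text \<open>The family concentrated in degree \<open>g\<close> sums to \<open>x\<close>, and
  decompositions are unique.\<close>

lemma homog_homogeneous:
  assumes "g \<in> carrier G" "x \<in> A g"
  shows "homog x = (\<lambda>h\<in>carrier G. if h = g then x else \<zero>\<^bsub>R\<^esub>)"
proof -
  define f where "f = (\<lambda>h\<in>carrier G. if h = g then x else \<zero>\<^bsub>R\<^esub>)"
  have x: "x \<in> carrier R"
    using assms component_subset by auto
  have "{h \<in> carrier G. f h \<noteq> \<zero>\<^bsub>R\<^esub>} \<subseteq> {g}"
    by (auto simp: f_def)
  then have "finite {h \<in> carrier G. f h \<noteq> \<zero>\<^bsub>R\<^esub>}"
    by (rule finite_subset) simp
  moreover have "f \<in> (\<Pi>\<^sub>E h\<in>carrier G. A h)"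
    using assms additive_subgroup.zero_closed[OF component_subgroup] by (auto simp: f_def)
  ultimately have f: "f \<in> finite_families R A (carrier G)"
    by (simp add: finite_families_def)
  have "family_sum R (carrier G) f = (\<Oplus>\<^bsub>R\<^esub>h\<in>{g}. f h)"
    using assms x by (intro R.family_sum_eq_finsum) (auto simp: f_def)
  also have "\<dots> = x"
    using assms x by (simp add: f_def R.finsum_insert)
  finally show ?thesis
    using homog_family_sum[OF f] by (simp add: f_def)
qed

lemma projection_homogeneous:
  assumes "U \<subseteq> carrier G" "g \<in> carrier G" "x \<in> A g"
  shows "projection U x = (if g \<in> U then x else \<zero>\<^bsub>R\<^esub>)"
proof -
  have x: "x \<in> carrier R"
    using assms component_subset by auto
  have "support x \<subseteq> {g}"
    using homog_homogeneous[OF assms(2,3)] by (auto simp: support_def split: if_splits)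
  then have "projection U x = (\<Oplus>\<^bsub>R\<^esub>g\<in>U \<inter> {g}. homog x g)"
    using assms x by (intro projection_eq_finsum) auto
  then show ?thesis
    using assms x homog_homogeneous[OF assms(2,3)] by (auto simp: R.finsum_insert)
qed

lemma projection_zero: "U \<subseteq> carrier G \<Longrightarrow> projection U \<zero>\<^bsub>R\<^esub> = \<zero>\<^bsub>R\<^esub>"
  using projection_homogeneous[of U "\<one>\<^bsub>G\<^esub>" "\<zero>\<^bsub>R\<^esub>"] additive_subgroup.zero_closed[OF component_subgroup]
  by auto

lemma projection_finsum:
  assumes "U \<subseteq> carrier G" "f \<in> F \<rightarrow> carrier R"
  shows "projection U (\<Oplus>\<^bsub>R\<^esub>i\<in>F. f i) = (\<Oplus>\<^bsub>R\<^esub>i\<in>F. projection U (f i))"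
  using assms(2)
proof (induction F rule: infinite_finite_induct)
  case (insert i F)
  then show ?case
    using assms(1) by (simp add: projection_add projection_closed Pi_def R.finsum_insert)
qed (use assms(1) in \<open>auto simp: projection_zero\<close>)

lemma projection_idem:
  assumes "U \<subseteq> carrier G" "x \<in> carrier R"
  shows "projection U (projection U x) = projection U x"
proof -
  have eq: "projection U x = (\<Oplus>\<^bsub>R\<^esub>g\<in>U \<inter> support x. homog x g)"
    using assms finite_support by (intro projection_eq_finsum) auto
  then have "projection U (projection U x) = (\<Oplus>\<^bsub>R\<^esub>g\<in>U \<inter> support x. projection U (homog x g))"
    using assms by (simp add: projection_finsum subset_iff)
  also have "\<dots> = projection U x"
    unfolding eq using assms
    by (intro R.finsum_cong') (auto simp: projection_homogeneous[OF _ _ homog_mem] subset_iff)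
  finally show ?thesis .
qed

text \<open>By the hypothesis on \<open>P\<close>, the products of degrees from \<open>U\<close> and
  \<open>V\<close> lie all in \<open>W\<close> or all outside \<open>W\<close>. After expansion into
  homogeneous terms the projection therefore keeps every term or kills every term.\<close>

lemma projection_mult:
  assumes "U \<subseteq> carrier G" "V \<subseteq> carrier G" "W \<subseteq> carrier G" "x \<in> carrier R" "y \<in> carrier R"
    and P: "\<And>g h. \<lbrakk>g \<in> U; h \<in> V\<rbrakk> \<Longrightarrow> g \<otimes>\<^bsub>G\<^esub> h \<in> W \<longleftrightarrow> P"
  shows "projection W (projection U x \<otimes>\<^bsub>R\<^esub> projection V y) = (if P then projection U x \<otimes>\<^bsub>R\<^esub> projection V y else \<zero>\<^bsub>R\<^esub>)"
proof -
  define S where "S = U \<inter> support x"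
  define T where "T = V \<inter> support y"
  have S: "finite S" "S \<subseteq> U" "S \<subseteq> carrier G" and T: "finite T" "T \<subseteq> V" "T \<subseteq> carrier G"
    using assms finite_support by (auto simp: S_def T_def)
  define m where "m g h = homog x g \<otimes>\<^bsub>R\<^esub> homog y h" for g h
  have m [simp]: "m g h \<in> carrier R" if "g \<in> S" "h \<in> T" for g h
    using that S T assms by (simp add: m_def subset_iff)
  have "projection U x = (\<Oplus>\<^bsub>R\<^esub>g\<in>S. homog x g)" "projection V y = (\<Oplus>\<^bsub>R\<^esub>h\<in>T. homog y h)"
    unfolding S_def T_def using assms finite_support by (auto intro!: projection_eq_finsum)
  then have "projection U x \<otimes>\<^bsub>R\<^esub> projection V y = (\<Oplus>\<^bsub>R\<^esub>g\<in>S. homog x g \<otimes>\<^bsub>R\<^esub> (\<Oplus>\<^bsub>R\<^esub>h\<in>T. homog y h))"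
    using S T assms by (simp add: R.finsum_ldistr R.finsum_closed Pi_iff subset_iff)
  also have "\<dots> = (\<Oplus>\<^bsub>R\<^esub>g\<in>S. \<Oplus>\<^bsub>R\<^esub>h\<in>T. m g h)"
    using S T assms by (intro R.finsum_cong') (auto simp: m_def R.finsum_rdistr Pi_iff subset_iff intro!: R.finsum_closed)
  finally have eq: "projection U x \<otimes>\<^bsub>R\<^esub> projection V y = (\<Oplus>\<^bsub>R\<^esub>g\<in>S. \<Oplus>\<^bsub>R\<^esub>h\<in>T. m g h)" .
  have pm: "projection W (m g h) = (if P then m g h else \<zero>\<^bsub>R\<^esub>)" if "g \<in> S" "h \<in> T" for g h
  proof -
    have gh: "g \<in> U" "h \<in> V" "g \<in> carrier G" "h \<in> carrier G"
      using that S T by auto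
    then have "m g h \<in> A (g \<otimes>\<^bsub>G\<^esub> h)"
      unfolding m_def using assms by (intro component_mult homog_mem)
    then show ?thesis
      using projection_homogeneous[OF assms(3), of "g \<otimes>\<^bsub>G\<^esub> h"] P gh by simp
  qed
  have "projection W (projection U x \<otimes>\<^bsub>R\<^esub> projection V y) = (\<Oplus>\<^bsub>R\<^esub>g\<in>S. projection W (\<Oplus>\<^bsub>R\<^esub>h\<in>T. m g h))"
    unfolding eq using assms(3) by (intro projection_finsum) (auto intro!: R.finsum_closed)
  also have "\<dots> = (\<Oplus>\<^bsub>R\<^esub>g\<in>S. \<Oplus>\<^bsub>R\<^esub>h\<in>T. projection W (m g h))"
    using assms(3) by (intro R.finsum_cong') (auto intro!: projection_finsum R.finsum_closed projection_closed)
  also have "\<dots> = (\<Oplus>\<^bsub>R\<^esub>g\<in>S. \<Oplus>\<^bsub>R\<^esub>h\<in>T. if P then m g h else \<zero>\<^bsub>R\<^esub>)"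
    using pm by (intro R.finsum_cong') (auto intro!: R.finsum_closed R.finsum_cong')
  finally show ?thesis
    by (cases P) (simp_all add: eq R.finsum_zero)
qed

lemma projection_in_component_sum:
  assumes "U \<subseteq> carrier G" "x \<in> carrier R"
  shows "projection U x \<in> component_sum R A U"
proof -
  \<comment> \<open>A family over \<open>U\<close> has to be \<open>undefined\<close> outside
    \<open>U\<close>, hence the restriction; it leaves the support within \<open>U\<close>
    unchanged.\<close>
  have "{g \<in> U. restrict (homog x) U g \<noteq> \<zero>\<^bsub>R\<^esub>} = {g \<in> U. homog x g \<noteq> \<zero>\<^bsub>R\<^esub>}"
    by auto
  moreover have "{g \<in> U. homog x g \<noteq> \<zero>\<^bsub>R\<^esub>} \<subseteq> support x"
    using assms by (auto simp: support_def)
  then have "finite {g \<in> U. homog x g \<noteq> \<zero>\<^bsub>R\<^esub>}"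
    using finite_support[OF assms(2)] by (rule finite_subset)
  ultimately have "restrict (homog x) U \<in> finite_families R A U"
    using assms homog_mem by (auto simp: finite_families_def)
  moreover have "projection U x = family_sum R U (restrict (homog x) U)"
    unfolding projection_def family_sum_def using assms
    by (intro R.finsum_cong') auto
  ultimately show ?thesis
    by (auto simp: component_sum_def)
qed

text \<open>The homogeneous components of \<open>x\<close> are regrouped by coset: cosets are
  disjoint and cover the group, and only the finitely many that meet the support of \<open>x\<close>
  contribute.\<close>

lemma coset_decomposition:
  assumes H: "subgroup H G" and x: "x \<in> carrier R"
  shows "\<exists>F. finite F \<and> F \<subseteq> rcosets\<^bsub>G\<^esub> H \<and> (\<forall>c\<in>rcosets\<^bsub>G\<^esub> H - F. projection c x = \<zero>\<^bsub>R\<^esub>)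
    \<and> (\<Oplus>\<^bsub>R\<^esub>c\<in>F. projection c x) = x"
proof -
  define S where "S = support x"
  define F where "F = {c \<in> rcosets\<^bsub>G\<^esub> H. c \<inter> S \<noteq> {}}"
  have S: "finite S" "S \<subseteq> carrier G"
    using x finite_support support_subset by (auto simp: S_def)
  have sub: "c \<subseteq> carrier G" if "c \<in> rcosets\<^bsub>G\<^esub> H" for c
    using G.rcosets_part_G[OF H] that by blast
  have disj: "c \<inter> d = {}" if "c \<in> rcosets\<^bsub>G\<^esub> H" "d \<in> rcosets\<^bsub>G\<^esub> H" "c \<noteq> d" for c d
    using G.rcos_disjoint[OF H] that by (auto simp: pairwise_def disjnt_def)
  \<comment> \<open>A coset meeting \<open>S\<close> is the coset of any of its members in
    \<open>S\<close>.\<close>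
  have "F \<subseteq> (\<lambda>g. H #>\<^bsub>G\<^esub> g) ` S"
    using G.repr_independence[OF _ _ H] by (fastforce simp: F_def RCOSETS_def)
  then have F: "finite F"
    using S(1) by (meson finite_imageI finite_subset)
  have eq: "projection c x = (\<Oplus>\<^bsub>R\<^esub>g\<in>c \<inter> S. homog x g)" if "c \<in> rcosets\<^bsub>G\<^esub> H" for c
    using S x sub[OF that] by (intro projection_eq_finsum) (auto simp: S_def)
  have "(\<Oplus>\<^bsub>R\<^esub>c\<in>F. projection c x) = (\<Oplus>\<^bsub>R\<^esub>c\<in>F. \<Oplus>\<^bsub>R\<^esub>g\<in>c \<inter> S. homog x g)"
    using x S eq by (intro R.finsum_cong') (auto simp: F_def intro!: R.finsum_closed)
  also have "\<dots> = (\<Oplus>\<^bsub>R\<^esub>g\<in>(\<Union>c\<in>F. c \<inter> S). homog x g)"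
  proof (rule R.add.finprod_UN_disjoint[symmetric])
    show "pairwise (\<lambda>i j. disjnt (i \<inter> S) (j \<inter> S)) F"
      using disj by (fastforce simp: pairwise_def disjnt_def F_def)
  qed (use F S x in auto)
  also have "(\<Union>c\<in>F. c \<inter> S) = carrier G \<inter> S"
    using G.rcosets_part_G[OF H] S by (fastforce simp: F_def)
  also have "(\<Oplus>\<^bsub>R\<^esub>g\<in>carrier G \<inter> S. homog x g) = projection (carrier G) x"
    using S x by (intro projection_eq_finsum[symmetric]) (auto simp: S_def)
  also have "\<dots> = x"
    using x by (simp add: projection_def homog_family)
  finally have "(\<Oplus>\<^bsub>R\<^esub>c\<in>F. projection c x) = x" .
  moreover have "projection c x = \<zero>\<^bsub>R\<^esub>" if "c \<in> rcosets\<^bsub>G\<^esub> H - F" for c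
    using that eq[of c] by (simp add: F_def)
  ultimately show ?thesis
    using F by (intro exI[of _ F]) (auto simp: F_def)
qed

lemma graded_projections_FactGroup:
  assumes R: "cring R" and H: "subgroup H G"
  shows "graded_projections (G Mod H) R projection"
proof -
  interpret cring R by (rule R)
  interpret H: normal H G
    using H by (simp add: G.normal_iff_subgroup)
  have carr: "carrier (G Mod H) = rcosets\<^bsub>G\<^esub> H"
    by (simp add: FactGroup_def)
  have sub: "c \<subseteq> carrier G" if "c \<in> rcosets\<^bsub>G\<^esub> H" for c
    using G.rcosets_part_G[OF H] that by blast
  show ?thesis
  proof (intro graded_projections.intro graded_projections_axioms.intro)
    show "comm_group (G Mod H)"
      by (rule G.abelian_FactGroup[OF H])
    fix a b c x y
    assume abc: "a \<in> carrier (G Mod H)" "b \<in> carrier (G Mod H)" "c \<in> carrier (G Mod H)"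
      and xy: "x \<in> carrier R" "y \<in> carrier R"
    \<comment> \<open>This supplies \<open>P\<close> for \<open>projection_mult\<close>: the product
      of two cosets is a coset, and distinct cosets are disjoint, so it is the only coset containing
      the product of \<open>g\<close> and \<open>h\<close>.\<close>
    have "g \<otimes>\<^bsub>G\<^esub> h \<in> c \<longleftrightarrow> c = a \<otimes>\<^bsub>G Mod H\<^esub> b" if "g \<in> a" "h \<in> b" for g h
    proof -
      have "g \<otimes>\<^bsub>G\<^esub> h \<in> a <#>\<^bsub>G\<^esub> b"
        using that by (auto simp: set_mult_def)
      moreover have "a <#>\<^bsub>G\<^esub> b \<in> rcosets\<^bsub>G\<^esub> H"
        using abc H.setmult_closed by (simp add: carr)
      ultimately show ?thesis
        using abc G.rcos_disjoint[OF H] by (auto simp: carr pairwise_def disjnt_def)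
    qed
    then show "projection c (projection a x \<otimes>\<^bsub>R\<^esub> projection b y)
      = (if c = a \<otimes>\<^bsub>G Mod H\<^esub> b then projection a x \<otimes>\<^bsub>R\<^esub> projection b y else \<zero>\<^bsub>R\<^esub>)"
      using abc xy sub by (intro projection_mult) (auto simp: carr)
  qed (use R sub coset_decomposition[OF H] in \<open>auto simp: carr projection_closed projection_add projection_idem\<close>)
qed

end

section \<open>The quotient by the torsion subgroup\<close>

lemma (in comm_group) torsion_free_FactGroup:
  "torsion_free_comm_group (G Mod torsion_subgroup G)"
proof -
  let ?H = "torsion_subgroup G"
  interpret H: normal ?H G
    by (simp add: normal_iff_subgroup subgroup_torsion_subgroup)
  interpret Q: comm_group "G Mod ?H"
    by (rule abelian_FactGroup[OF subgroup_torsion_subgroup])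
  show ?thesis
  proof
    fix c and n :: nat
    assume c: "c \<in> carrier (G Mod ?H)" "n > 0" "c [^]\<^bsub>G Mod ?H\<^esub> n = \<one>\<^bsub>G Mod ?H\<^esub>"
    then obtain g where g: "g \<in> carrier G" "c = ?H #> g"
      by (auto simp: carrier_FactGroup)
    have "?H #> (g [^] n) = ?H"
      using c g by (simp add: H.FactGroup_pow)
    then have "g [^] n \<in> ?H"
      using g coset_join1 subgroup_torsion_subgroup by simp
    \<comment> \<open>Since \<open>n\<close> kills the class of \<open>g\<close>, the power
      \<open>g^n\<close> is torsion; the product \<open>n * m\<close> of the exponents then kills
      \<open>g\<close> itself.\<close>
    then obtain m :: nat where "m > 0" "(g [^] n) [^] m = \<one>"
      unfolding torsion_subgroup_def by blast
    then have "n * m > 0" "g [^] (n * m) = \<one>"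
      using g(1) c(2) by (simp_all add: nat_pow_pow)
    then have "g \<in> ?H"
      using g(1) unfolding torsion_subgroup_def by blast
    then show "c = \<one>\<^bsub>G Mod ?H\<^esub>"
      using g coset_join2 subgroup_torsion_subgroup by simp
  qed
qed

theorem theorem6p5:
  fixes G :: "('g, 'm) monoid_scheme"
    and R :: "('a, 'r) ring_scheme"
    and A :: "'g \<Rightarrow> 'a set"
  assumes "comm_group G"
    and "cring R"
    and "graded_ring G R A"
    and "e \<in> carrier R"
    and "e \<otimes>\<^bsub>R\<^esub> e = e"
  shows "e \<in> component_sum R A (torsion_subgroup G)"
proof -
  interpret graded_ring G R A
    by fact
  have H: "subgroup (torsion_subgroup G) G"
    by (rule G.subgroup_torsion_subgroup)
  interpret T: torsion_free_graded_projections "G Mod torsion_subgroup G" R projection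
    by (intro torsion_free_graded_projections.intro graded_projections_FactGroup
        G.torsion_free_FactGroup H assms)
  \<comment> \<open>The identity of the quotient is the torsion subgroup itself, viewed as a coset,
    so the component of degree zero is the projection onto it.\<close>
  have "projection (torsion_subgroup G) e = e"
    using T.idempotent_homogeneous[OF assms(4,5)] by simp
  then show ?thesis
    using projection_in_component_sum[OF subgroup.subset[OF H] assms(4)] by simp
qed

end
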